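(* For all integers $n\geq 1$, $$\sum_{k=0}^{2n} \binom{2n+k}{2k} \binom{2k}{k}^2 2^{-2k} (2k+1) \frac{(-1)^k}{(2n+k)(k+1)^2} = \frac{2^{-4n}}{n^3} \binom{2(n-1)}{n-1}^2$$ and $$\sum_{k=0}^{2n+1} \binom{2n+1+k}{2k} \binom{2k}{k}^2 2^{-2k} (2k+1) \frac{(-1)^k}{(2n+1+k)(k+1)^2} = \frac{2^{-(4n+3)}}{(2n+1)(n+1)^2} \binom{2n}{n}^2.$$ *)

theory Defs
  imports Complex_Main
begin

end

theory Submission
  imports Defs
begin

text \<open>
  Both identities evaluate the terminating series
  \<open>S(m) = 1/m \<cdot> \<^sub>3F\<^sub>2(m, -m, 3/2; 2, 2; 1)\<close>
  at even and at odd \<open>m\<close> respectively: comparing the quotients of consecutive terms shows that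
  each summand is a hypergeometric term (\<open>summand_hypergeometric\<close>).

  The values at the two parities have different shapes, so no first-order recurrence with
  polynomial coefficients serves both. There is one of second order,
  \<open>c\<^sub>0(m) S(m) + c\<^sub>1(m) S(m+1) + c\<^sub>2(m) S(m+2) = 0\<close>, obtained by creative telescoping. All three
  terms \<open>t(m,k)\<close>, \<open>t(m+1,k)\<close>, \<open>t(m+2,k)\<close> are quadratic polynomials in \<open>k\<close> times a common
  hypergeometric factor \<open>b(m,k)\<close>. For \<open>G(k) = -2 k (k+1)\<^sup>2 b(m,k)\<close> the cubic parts of
  \<open>G(k+1) - G(k)\<close> cancel, so this difference is also a quadratic times \<open>b(m,k)\<close>; as the three
  quadratics span all polynomials of degree at most two in \<open>k\<close>, some combination of the terms
  equals the difference (\<open>telescoping\<close>). Summing over \<open>k\<close> gives the recurrence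
  (\<open>hyp_sum_recurrence\<close>), because \<open>G\<close> vanishes at both ends of the range.

  As \<open>c\<^sub>2(m) \<noteq> 0\<close>, the recurrence together with \<open>S(2)\<close> and \<open>S(3)\<close> determines all later
  values, and the closed forms satisfy it (\<open>hyp_sum_eval\<close>).
\<close>

section \<open>The hypergeometric term and its shifts\<close>

definition weight :: "nat \<Rightarrow> real" where
  "weight k = pochhammer (3/2) k / (fact k * fact (Suc k) ^ 2)"

definition hyp_term :: "real \<Rightarrow> nat \<Rightarrow> real" where
  "hyp_term x k = pochhammer x k * pochhammer (- x) k * weight k / x"

definition hyp_sum :: "nat \<Rightarrow> real" where
  "hyp_sum m = (\<Sum>k=0..m. hyp_term (real m) k)"

lemma weight_Suc:
  "weight (Suc k) = weight k * (2 * real k + 3) / (2 * (real k + 1) * (real k + 2) ^ 2)"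
proof -
  have "weight (Suc k) = (3/2 + real k) * pochhammer (3/2) k
          / (((real k + 1) * fact k) * ((real k + 2) * fact (Suc k)) ^ 2)"
    unfolding weight_def by (simp add: pochhammer_Suc algebra_simps)
  also have "\<dots> = weight k * (2 * real k + 3) / (2 * (real k + 1) * (real k + 2) ^ 2)"
    unfolding weight_def
    by (simp add: divide_simps power_mult_distrib del: fact_Suc)
  finally show ?thesis .
qed

lemma pochhammer_shift:
  fixes x :: real
  assumes "x \<noteq> 0"
  shows "pochhammer (x + 1) k = pochhammer x k * (x + real k) / x"
  using pochhammer_rec[of x k] pochhammer_Suc[of x k] assms by (simp add: field_simps)

lemma hyp_term_beyond: "k > m \<Longrightarrow> hyp_term (real m) k = 0"
  by (simp add: hyp_term_def pochhammer_of_nat_eq_0_iff)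

lemma hyp_sum_extend:
  assumes "m \<le> N" shows "hyp_sum m = (\<Sum>k=0..N. hyp_term (real m) k)"
  unfolding hyp_sum_def
  by (rule sum.mono_neutral_left) (use assms in \<open>auto simp: hyp_term_beyond\<close>)

text \<open>
  The common factor of three neighbouring terms. Taking the second parameter as \<open>- x - 2\<close>, the
  lowest one that occurs, makes each of the three terms a polynomial multiple of it, so that
  no division by \<open>x - k\<close> or its shifts is needed when \<open>k\<close> reaches the end of the range.
\<close>
definition base_term :: "real \<Rightarrow> nat \<Rightarrow> real" where
  "base_term x k = pochhammer x k * pochhammer (- x - 2) k * weight k / (x * (x + 1) * (x + 2))"

lemma hyp_term_via_base:
  assumes "x > 0"
  shows "hyp_term x k = (x + 2 - k) * (x + 1 - k) * base_term x k"
    and "hyp_term (x + 1) k = (x + k) * (x + 2 - k) * base_term x k"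
    and "hyp_term (x + 2) k = (x + k) * (x + 1 + k) * base_term x k"
proof -
  have up1: "pochhammer (x + 1) k = pochhammer x k * (x + k) / x"
    using pochhammer_shift[of x k] assms by simp
  have up2: "pochhammer (x + 2) k = pochhammer x k * (x + k) / x * (x + 1 + k) / (x + 1)"
    using pochhammer_shift[of "x + 1" k] assms unfolding up1 by (simp add: add.commute)
  have flip: "(- x - 2 + real k) / (- x - 2) = (x + 2 - k) / (x + 2)"
    "(- x - 1 + real k) / (- x - 1) = (x + 1 - k) / (x + 1)"
    using assms by (simp_all add: divide_simps) (simp_all add: algebra_simps)
  have step: "- x - 2 + 1 = - x - 1" "- x - 1 + 1 = - x"
    by simp_all
  have down1: "pochhammer (- x - 1) k = pochhammer (- x - 2) k * ((x + 2 - k) / (x + 2))"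
    using pochhammer_shift[of "- x - 2" k] assms unfolding flip(1)[symmetric] step by simp
  have down2: "pochhammer (- x) k
      = pochhammer (- x - 2) k * ((x + 2 - k) / (x + 2)) * ((x + 1 - k) / (x + 1))"
    using pochhammer_shift[of "- x - 1" k] assms
    unfolding down1[symmetric] flip(2)[symmetric] step by simp
  show "hyp_term x k = (x + 2 - k) * (x + 1 - k) * base_term x k"
    unfolding hyp_term_def base_term_def down2 by (simp add: mult_ac)
  have "- (x + 1) = - x - 1" "- (x + 2) = - x - 2" by simp_all
  note neg = this
  show "hyp_term (x + 1) k = (x + k) * (x + 2 - k) * base_term x k"
    unfolding hyp_term_def base_term_def neg up1 down1 by (simp add: mult_ac)
  show "hyp_term (x + 2) k = (x + k) * (x + 1 + k) * base_term x k"
    unfolding hyp_term_def base_term_def neg up2 by (simp add: mult_ac)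
qed

section \<open>Creative telescoping\<close>

definition certificate :: "real \<Rightarrow> nat \<Rightarrow> real" where
  "certificate x k = - 2 * real k * (real k + 1) ^ 2 * base_term x k"

text \<open>
  The polynomial factor of the certificate is chosen so that, at \<open>k + 1\<close>, it cancels the
  denominator \<open>2 (k + 1) (k + 2)\<^sup>2\<close> of the term quotient of \<open>base_term\<close>. The factor
  \<open>x + 2 - k\<close> that remains makes the certificate vanish past the end of the summation range.
\<close>
lemma certificate_Suc:
  "certificate x (Suc k) = (x + k) * (x + 2 - k) * (2 * real k + 3) * base_term x k"
proof -
  define d where "d = 2 * (real k + 1) * (real k + 2) ^ 2"
  have "d \<noteq> 0" by (simp add: d_def add_nonneg_eq_0_iff)
  have "certificate x (Suc k) = - (d * base_term x (Suc k))"
    by (simp add: certificate_def d_def algebra_simps)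
  also have "base_term x (Suc k)
      = base_term x k * (x + k) * (- x - 2 + k) * (2 * real k + 3) / d"
    unfolding base_term_def weight_Suc pochhammer_Suc d_def by (simp add: mult_ac)
  also have "d * \<dots> = base_term x k * (x + k) * (- x - 2 + k) * (2 * real k + 3)"
    using \<open>d \<noteq> 0\<close> by simp
  finally show ?thesis by (simp add: algebra_simps)
qed

text \<open>
  The coefficients solve the equation of \<open>telescoping\<close> divided by the common factor. At
  \<open>k = - x\<close> and at \<open>k = x + 2\<close> only one of the three quadratics survives, which gives
  \<open>coeff0\<close> and \<open>coeff2\<close>; comparing the coefficients of \<open>k\<^sup>2\<close> then gives \<open>coeff1\<close>. All are
  multiplied by \<open>(x + 1) (2 x + 1) (2 x + 3)\<close> to clear denominators.
\<close>
definition coeff0 :: "real \<Rightarrow> real" where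
  "coeff0 x = - x * (x - 1) ^ 2 * (2 * x + 3)"

definition coeff2 :: "real \<Rightarrow> real" where
  "coeff2 x = (x + 2) * (x + 3) ^ 2 * (2 * x + 1)"

definition coeff1 :: "real \<Rightarrow> real" where
  "coeff1 x = coeff0 x + coeff2 x - 5 * (x + 1) * (2 * x + 1) * (2 * x + 3)"

lemma telescoping:
  assumes "x > 0"
  shows "coeff0 x * hyp_term x k + coeff1 x * hyp_term (x + 1) k + coeff2 x * hyp_term (x + 2) k
    = (x + 1) * (2 * x + 1) * (2 * x + 3) * (certificate x (Suc k) - certificate x k)"
  unfolding hyp_term_via_base[OF assms] certificate_Suc
  unfolding certificate_def coeff0_def coeff1_def coeff2_def
  by algebra

lemma hyp_sum_recurrence:
  assumes "m \<ge> 1"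
  shows "coeff0 m * hyp_sum m + coeff1 m * hyp_sum (m + 1) + coeff2 m * hyp_sum (m + 2) = 0"
proof -
  let ?x = "real m"
  \<comment> \<open>Terms beyond the natural range vanish, so all three sums may run up to \<open>m + 2\<close>.\<close>
  have sums: "hyp_sum m = (\<Sum>k=0..m+2. hyp_term ?x k)"
    "hyp_sum (m + 1) = (\<Sum>k=0..m+2. hyp_term (?x + 1) k)"
    "hyp_sum (m + 2) = (\<Sum>k=0..m+2. hyp_term (?x + 2) k)"
    using hyp_sum_extend[of m "m + 2"] hyp_sum_extend[of "m + 1" "m + 2"]
      hyp_sum_extend[of "m + 2" "m + 2"] by (simp_all add: add.commute)
  have "coeff0 m * hyp_sum m + coeff1 m * hyp_sum (m + 1) + coeff2 m * hyp_sum (m + 2)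
      = (\<Sum>k=0..m+2. coeff0 ?x * hyp_term ?x k + coeff1 ?x * hyp_term (?x + 1) k
                    + coeff2 ?x * hyp_term (?x + 2) k)"
    unfolding sums by (simp only: sum.distrib sum_distrib_left)
  also have "\<dots> = (?x + 1) * (2 * ?x + 1) * (2 * ?x + 3)
      * (\<Sum>k=0..m+2. certificate ?x (Suc k) - certificate ?x k)"
    using assms by (simp only: telescoping of_nat_0_less_iff sum_distrib_left)
  also have "(\<Sum>k=0..m+2. certificate ?x (Suc k) - certificate ?x k)
      = certificate ?x (Suc (m + 2)) - certificate ?x 0"
    by (rule sum_Suc_diff) simp
  also have "certificate ?x (Suc (m + 2)) = 0"
    unfolding certificate_Suc by simp
  also have "certificate ?x 0 = 0"
    by (simp add: certificate_def)
  finally show ?thesis by simp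
qed

section \<open>Evaluation of the sums\<close>

text \<open>
  The normalisation by \<open>4 ^ n\<close> turns the growth factor of the central binomial coefficients into
  a rational function tending to 1, and absorbs those powers of 2 in the closed forms that depend on \<open>n\<close>.
\<close>
definition wallis :: "nat \<Rightarrow> real" where
  "wallis n = ((2 * n) choose n) / 4 ^ n"

lemma central_binomial_Suc:
  "real ((2 * Suc n) choose Suc n) = 2 * (2 * real n + 1) / (real n + 1) * real ((2 * n) choose n)"
proof -
  have "Suc n * ((2 * Suc n) choose Suc n) = 2 * Suc n * (Suc (2 * n) choose n)"
    using Suc_times_binomial[of n "Suc (2 * n)"] by simp
  moreover have "Suc n * (Suc (2 * n) choose Suc n) = Suc (2 * n) * ((2 * n) choose n)"
    using Suc_times_binomial[of n "2 * n"] by simp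
  moreover have "(Suc (2 * n) choose n) = (Suc (2 * n) choose Suc n)"
    using binomial_symmetric[of n "Suc (2 * n)"] by simp
  ultimately have "Suc n * ((2 * Suc n) choose Suc n) = 2 * (Suc (2 * n) * ((2 * n) choose n))"
    by (metis mult.assoc mult.left_commute)
  then have "real (Suc n * ((2 * Suc n) choose Suc n))
      = real (2 * (Suc (2 * n) * ((2 * n) choose n)))"
    by (simp only:)
  then show ?thesis by (simp add: field_simps del: binomial_Suc_Suc)
qed

lemma wallis_Suc: "wallis (Suc n) = (2 * real n + 1) / (2 * (real n + 1)) * wallis n"
  unfolding wallis_def central_binomial_Suc by (simp add: divide_simps) (simp add: algebra_simps)

text \<open>
  The induction carries an even and the next odd argument together, as the recurrence needs two
  consecutive values. It starts at 2 because the odd formula, extended to \<open>S(1)\<close>, would give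
  \<open>1/8\<close> instead of \<open>5/8\<close>; the recurrence does not see this, as \<open>coeff0 1 = 0\<close>.
\<close>
lemma hyp_sum_eval:
  "hyp_sum (2 * n + 2) = wallis n ^ 2 / (16 * (real n + 1) ^ 3)
   \<and> hyp_sum (2 * n + 3) = wallis (Suc n) ^ 2 / (8 * (2 * real n + 3) * (real n + 2) ^ 2)"
proof (induction n)
  case 0
  have "hyp_sum (Suc (Suc 0)) = 1 / 16" "hyp_sum 3 = 1 / 384"
    by (simp_all add: hyp_sum_def hyp_term_def weight_def eval_nat_numeral pochhammer_Suc)
  then show ?case by (simp add: wallis_Suc) (simp add: wallis_def power2_eq_square)
next
  case (Suc n)
  define y where "y = real n"
  define w where "w = wallis n ^ 2"
  define w' where "w' = ((2 * y + 1) / (2 * (y + 1))) ^ 2 * w"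
  define w'' where "w'' = ((2 * y + 3) / (2 * (y + 2))) ^ 2 * w'"
  have w'_eq: "w' = w * (2 * y + 1) ^ 2 / (4 * (y + 1) ^ 2)"
    unfolding w'_def by (simp only: power_divide power_mult_distrib) simp
  have w''_eq: "w'' = w' * (2 * y + 3) ^ 2 / (4 * (y + 2) ^ 2)"
    unfolding w''_def by (simp only: power_divide power_mult_distrib) simp
  have w': "wallis (Suc n) ^ 2 = w'"
    unfolding wallis_Suc w'_def w_def y_def by (simp only: power_mult_distrib)
  have "wallis (Suc (Suc n)) = (2 * y + 3) / (2 * (y + 2)) * wallis (Suc n)"
    unfolding wallis_Suc[of "Suc n"] y_def by (simp add: add.commute)
  then have w'': "wallis (Suc (Suc n)) ^ 2 = w''"
    unfolding w''_def w'[symmetric] by (simp only: power_mult_distrib)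
  have y: "y \<ge> 0" by (simp add: y_def)
  then have nz: "y + 1 \<noteq> 0" "y + 2 \<noteq> 0" "y + 3 \<noteq> 0" "2 * y + 3 \<noteq> 0" "2 * y + 5 \<noteq> 0" by auto
  have S2: "hyp_sum (2 * n + 2) = w / (16 * (y + 1) ^ 3)"
    and S3: "hyp_sum (2 * n + 3) = w' / (8 * (2 * y + 3) * (y + 2) ^ 2)"
    using Suc.IH unfolding w' by (simp_all add: y_def w_def)
  have rec2: "coeff0 (2 * y + 2) * hyp_sum (2 * n + 2) + coeff1 (2 * y + 2) * hyp_sum (2 * n + 3)
      + coeff2 (2 * y + 2) * hyp_sum (2 * n + 4) = 0"
    using hyp_sum_recurrence[of "2 * n + 2"]
    by (simp add: y_def add.commute eval_nat_numeral)
  have rec3: "coeff0 (2 * y + 3) * hyp_sum (2 * n + 3) + coeff1 (2 * y + 3) * hyp_sum (2 * n + 4)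
      + coeff2 (2 * y + 3) * hyp_sum (2 * n + 5) = 0"
    using hyp_sum_recurrence[of "2 * n + 3"]
    by (simp add: y_def add.commute eval_nat_numeral)
  \<comment> \<open>The recurrence determines its last entry, so it suffices that the closed forms solve it.\<close>
  have pos: "coeff2 (2 * y + 2) \<noteq> 0" "coeff2 (2 * y + 3) \<noteq> 0"
    using y by (auto simp: coeff2_def)
  define d4 where "d4 = w' / (16 * (y + 2) ^ 3)"
  define d5 where "d5 = w'' / (8 * (2 * y + 5) * (y + 3) ^ 2)"
  have "coeff0 (2 * y + 2) * hyp_sum (2 * n + 2) + coeff1 (2 * y + 2) * hyp_sum (2 * n + 3)
      + coeff2 (2 * y + 2) * d4 = 0"
    unfolding S2 S3 d4_def w'_eq coeff0_def coeff1_def coeff2_def using nz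
    by (simp add: divide_simps) algebra
  with rec2 pos have S4: "hyp_sum (2 * n + 4) = d4" by (metis add_left_cancel mult_left_cancel)
  have "coeff0 (2 * y + 3) * hyp_sum (2 * n + 3) + coeff1 (2 * y + 3) * hyp_sum (2 * n + 4)
      + coeff2 (2 * y + 3) * d5 = 0"
    unfolding S3 S4 d4_def d5_def w''_eq coeff0_def coeff1_def coeff2_def using nz
    by (simp add: divide_simps) algebra
  with rec3 pos have S5: "hyp_sum (2 * n + 5) = d5" by (metis add_left_cancel mult_left_cancel)
  show ?case
    using S4 S5 unfolding w' w'' d4_def d5_def
    by (simp add: y_def eval_nat_numeral add.commute)
qed

section \<open>From binomial coefficients to the hypergeometric term\<close>

lemma choose_diagonal_Suc:
  "real ((m + Suc k) choose (2 * Suc k))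
    = real ((m + k) choose (2 * k)) * ((real m + real k + 1) * (real m - real k))
      / ((2 * real k + 1) * (2 * real k + 2))"
proof (cases "k \<le> m")
  case True
  have "Suc (2 * k + 1) * (Suc (m + k) choose Suc (2 * k + 1)) = Suc (m + k) * ((m + k) choose (2 * k + 1))"
    by (rule Suc_times_binomial)
  then have a: "real (Suc (2 * k + 1)) * real (Suc (m + k) choose Suc (2 * k + 1))
      = real (Suc (m + k)) * real ((m + k) choose (2 * k + 1))"
    by (metis of_nat_mult)
  have "Suc (2 * k) * ((m + k) choose Suc (2 * k)) = (m + k - 2 * k) * ((m + k) choose (2 * k))"
    by (metis binomial_absorb_comp binomial_absorption)
  then have b: "real (Suc (2 * k)) * real ((m + k) choose (2 * k + 1))
      = real (m + k - 2 * k) * real ((m + k) choose (2 * k))"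
    by (metis of_nat_mult Suc_eq_plus1)
  have c: "real (m + k - 2 * k) = real m - real k" using True by (simp add: of_nat_diff)
  have e: "real ((m + k) choose (2 * k + 1))
      = (real m - real k) * real ((m + k) choose (2 * k)) / (2 * real k + 1)"
    using b unfolding c by (simp add: field_simps)
  have f: "m + Suc k = Suc (m + k)" "2 * Suc k = Suc (2 * k + 1)" by simp_all
  have "real ((m + Suc k) choose (2 * Suc k))
      = real (Suc (m + k)) * real ((m + k) choose (2 * k + 1)) / (2 * real k + 2)"
    unfolding f using a by (simp add: field_simps del: binomial_Suc_Suc)
  then show ?thesis unfolding e by (simp add: field_simps)
next
  case False
  then show ?thesis by (simp add: binomial_eq_0)
qed

text \<open>
  Both sides agree at \<open>k = 0\<close> and have the same term quotient
  \<open>- (m + k) (m - k) (2 k + 3) / (2 (k + 1) (k + 2)\<^sup>2)\<close>.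
\<close>
lemma summand_hypergeometric:
  assumes "m \<ge> 1"
  shows "real ((m + k) choose (2 * k)) * real ((2 * k) choose k) ^ 2
      * 2 powi (- int (2 * k)) * (2 * real k + 1)
      * ((-1) ^ k / ((real m + real k) * (real k + 1) ^ 2)) = hyp_term m k"
proof -
  have "real ((m + k) choose (2 * k)) * real ((2 * k) choose k) ^ 2 / 4 ^ k * (2 * real k + 1)
      * ((-1) ^ k / ((real m + real k) * (real k + 1) ^ 2)) = hyp_term m k"
  proof (induction k)
    case 0
    then show ?case by (simp add: hyp_term_def weight_def)
  next
    case (Suc k)
    define a where "a = real ((m + k) choose (2 * k))"
    define b where "b = real ((2 * k) choose k)"
    have pos: "real m + real k > 0" "real m + real k + 1 > 0" using assms by simp_all
    have "hyp_term m (Suc k) = hyp_term m k * ((real m + k) * (k - real m) * (2 * real k + 3)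
        / (2 * (real k + 1) * (real k + 2) ^ 2))"
      unfolding hyp_term_def weight_Suc pochhammer_Suc by (simp add: mult_ac)
    also have "\<dots> = a * b ^ 2 / 4 ^ k * (2 * real k + 1)
        * ((-1) ^ k / ((real m + real k) * (real k + 1) ^ 2))
        * ((real m + k) * (k - real m) * (2 * real k + 3) / (2 * (real k + 1) * (real k + 2) ^ 2))"
      unfolding Suc.IH[symmetric] a_def b_def ..
    also have "\<dots> = a * ((real m + real k + 1) * (real m - real k))
          / ((2 * real k + 1) * (2 * real k + 2))
        * (2 * (2 * real k + 1) / (real k + 1) * b) ^ 2 / 4 ^ Suc k * (2 * real k + 3)
        * ((-1) ^ Suc k / ((real m + real k + 1) * (real k + 2) ^ 2))"
      using pos by (simp add: divide_simps) algebra
    finally show ?case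
      unfolding choose_diagonal_Suc central_binomial_Suc a_def b_def
      by (simp add: add.commute add.left_commute)
  qed
  moreover have "(2::real) powi (- int (2 * k)) = 1 / 4 ^ k"
    by (simp add: power_int_minus power_mult inverse_eq_divide flip: of_nat_mult)
  ultimately show ?thesis by (simp del: of_nat_mult)
qed

theorem theorem3p10:
  fixes n :: nat
  assumes "n \<ge> 1"
  shows "(\<Sum>k=0..2*n. real ((2*n + k) choose (2*k)) * real ((2*k) choose k) ^ 2
            * 2 powi (- int (2*k)) * (2 * real k + 1)
            * ((-1) ^ k / ((2 * real n + real k) * (real k + 1) ^ 2)))
          = 2 powi (- int (4*n)) / real n ^ 3 * real ((2*(n-1)) choose (n-1)) ^ 2
       \<and> (\<Sum>k=0..2*n+1. real ((2*n + 1 + k) choose (2*k)) * real ((2*k) choose k) ^ 2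
            * 2 powi (- int (2*k)) * (2 * real k + 1)
            * ((-1) ^ k / ((2 * real n + 1 + real k) * (real k + 1) ^ 2)))
          = 2 powi (- int (4*n + 3)) / ((2 * real n + 1) * (real n + 1) ^ 2)
            * real ((2*n) choose n) ^ 2"
proof
  have "(\<Sum>k=0..2*n. real ((2*n + k) choose (2*k)) * real ((2*k) choose k) ^ 2
            * 2 powi (- int (2*k)) * (2 * real k + 1)
            * ((-1) ^ k / ((2 * real n + real k) * (real k + 1) ^ 2))) = hyp_sum (2 * n)"
    unfolding hyp_sum_def
    using summand_hypergeometric[of "2 * n"] assms by (intro sum.cong) auto
  also have "\<dots> = wallis (n - 1) ^ 2 / (16 * real n ^ 3)"
    using hyp_sum_eval[of "n - 1"] assms by (cases n) (auto simp: add.commute)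
  also have "\<dots> = 2 powi (- int (4*n)) / real n ^ 3 * real ((2*(n-1)) choose (n-1)) ^ 2"
  proof -
    have "(2::real) powi (- int (4 * n)) = inverse (2 ^ (4 * n))"
      by (simp only: power_int_minus power_int_of_nat)
    also have "\<dots> = 1 / (16 * (4 ^ (n - 1)) ^ 2)"
      using assms
      by (cases n) (simp_all add: power_add power_mult inverse_eq_divide power2_eq_square
          power_mult_distrib[symmetric])
    finally have "(2::real) powi (- int (4 * n)) = 1 / (16 * (4 ^ (n - 1)) ^ 2)" .
    then show ?thesis by (simp add: wallis_def power_divide)
  qed
  finally show "(\<Sum>k=0..2*n. real ((2*n + k) choose (2*k)) * real ((2*k) choose k) ^ 2
            * 2 powi (- int (2*k)) * (2 * real k + 1)
            * ((-1) ^ k / ((2 * real n + real k) * (real k + 1) ^ 2)))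
          = 2 powi (- int (4*n)) / real n ^ 3 * real ((2*(n-1)) choose (n-1)) ^ 2" .
next
  have "(\<Sum>k=0..2*n+1. real ((2*n + 1 + k) choose (2*k)) * real ((2*k) choose k) ^ 2
            * 2 powi (- int (2*k)) * (2 * real k + 1)
            * ((-1) ^ k / ((2 * real n + 1 + real k) * (real k + 1) ^ 2))) = hyp_sum (2 * n + 1)"
    unfolding hyp_sum_def
  proof (intro sum.cong refl)
    fix k
    have cast: "real (2 * n + 1) = 2 * real n + 1" by simp
    show "real ((2*n + 1 + k) choose (2*k)) * real ((2*k) choose k) ^ 2
            * 2 powi (- int (2*k)) * (2 * real k + 1)
            * ((-1) ^ k / ((2 * real n + 1 + real k) * (real k + 1) ^ 2))
          = hyp_term (real (2 * n + 1)) k"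
      unfolding cast by (rule summand_hypergeometric[of "2 * n + 1", unfolded cast]) simp
  qed
  also have "\<dots> = wallis n ^ 2 / (8 * (2 * real n + 1) * (real n + 1) ^ 2)"
    using hyp_sum_eval[of "n - 1"] assms
    by (cases n) (auto simp: add.commute eval_nat_numeral)
  also have "\<dots> = 2 powi (- int (4*n + 3)) / ((2 * real n + 1) * (real n + 1) ^ 2)
            * real ((2*n) choose n) ^ 2"
  proof -
    have "(2::real) powi (- int (4 * n + 3)) = inverse (2 ^ (4 * n + 3))"
      by (simp only: power_int_minus power_int_of_nat)
    also have "\<dots> = 1 / (8 * (4 ^ n) ^ 2)"
      by (simp add: power_add power_mult inverse_eq_divide power2_eq_square
          power_mult_distrib[symmetric])
    finally show ?thesis by (simp add: wallis_def power_divide)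
  qed
  finally show "(\<Sum>k=0..2*n+1. real ((2*n + 1 + k) choose (2*k)) * real ((2*k) choose k) ^ 2
            * 2 powi (- int (2*k)) * (2 * real k + 1)
            * ((-1) ^ k / ((2 * real n + 1 + real k) * (real k + 1) ^ 2)))
          = 2 powi (- int (4*n + 3)) / ((2 * real n + 1) * (real n + 1) ^ 2)
            * real ((2*n) choose n) ^ 2" .
qed

end
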